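(* Let $k\ge 1$. Consider the following universal statements over $k$-weakly-partition-connected labelled multihypergraphs $H$ (with $t$ denoting the number of vertices of $H$). (B) Every $k$-critical, $k$-weakly-partition-connected hypergraph has a $k$-distinguishable (full) tree assignment. (C) Every $k$-weakly-partition-connected hypergraph $H$ has a tree assignment $G$ and a labelled spanning subgraph $G'\subseteq G$ with $|E(G')|=k(t-1)$ such that $G'$ has a signature-unique ordered $k$-tree decomposition, where, for each label $e$, the signature coordinate is computed using the retained class $E(F_e)\cap E(G')$. (C$_>$) Statement (C) restricted to overfull hypergraphs, namely those satisfying $\rho(H)>k(t-1)$. Then (C) holds if and only if both (B) and (C$_>$) hold. In particular, the unrestricted pruning statement (C) implies the critical full-assignment statement (B); it is not logically independent of it.
   Context: A labelled multihypergraph $H=(V,E)$ has a finite vertex set $V$ with $t=|V|\ge 2$ and a finite set $E$ of hyperedge occurrences, each with a support that is a subset of $V$ of cardinality at least $2$ (standing assumptions); distinct occurrences may have the same support and remain distinct. We write $e$ both for the occurrence and its support. For a partition $\mathcal P$ of $V$ let $p_{\mathcal P}(e)$ be the number of blocks of $\mathcal P$ met by $e$, and $w_H(\mathcal P)=\sum_{e\in E}(p_{\mathcal P}(e)-1)$. $H$ is $k$-weakly-partition-connected if $w_H(\mathcal P)\ge k(|\mathcal P|-1)$ for every partition $\mathcal P$ of $V$. With $\rho(H)=\sum_{e\in E}(|e|-1)$, $H$ is $k$-critical if $\rho(H)=k(t-1)$. A tree assignment of $H$ chooses, for every $e\in E$, a simple tree $F_e$ with vertex set $e$ and labels every edge of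 $F_e$ by $e$; the assigned graph is the labelled multigraph $G=\biguplus_{e\in E}F_e$ on $V$ (disjoint union of labelled edge occurrences). An ordered $k$-tree decomposition of a labelled graph $G'$ on $V$ is an ordered partition $E(G')=E(T_0)\,\dot\cup\,\cdots\,\dot\cup\,E(T_{k-1})$ of all its edge occurrences in which every $T_i$ is a spanning tree of $V$ (containing no parallel pair). For $G'\subseteq G$ obtained by deleting edge occurrences (keeping all vertices), the signature of such a decomposition is the vector indexed by $e\in E$ with coordinates $\sum_{i=0}^{k-1} i\,|E(T_i)\cap E(F_e)\cap E(G')|$. A decomposition of $G'$ is signature-unique if every ordered $k$-tree decomposition of $G'$ with the same signature equals it. $G$ is $k$-distinguishable if $G$ itself ($G'=G$) has a signature-unique ordered $k$-tree decomposition. *)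

theory Defs
  imports "HOL-Library.Disjoint_Sets" "HOL-Library.FuncSet"
begin

section \<open>Labelled multihypergraphs\<close>

text \<open>
  Hyperedge occurrences are elements of the label type \<open>'e\<close>; two different labels
  may have the same support.
\<close>

record ('v, 'e) multihypergraph =
  verts :: "'v set"
  hedges :: "'e set"
  supp :: "'e \<Rightarrow> 'v set"

definition wf_multihypergraph :: "('v, 'e) multihypergraph \<Rightarrow> bool" where
  "wf_multihypergraph H \<longleftrightarrow>
     finite (verts H) \<and> card (verts H) \<ge> 2 \<and> finite (hedges H) \<and>
     (\<forall>e\<in>hedges H. supp H e \<subseteq> verts H \<and> card (supp H e) \<ge> 2)"

definition blocks_met :: "'v set set \<Rightarrow> 'v set \<Rightarrow> nat" where
  "blocks_met P s = card {B \<in> P. B \<inter> s \<noteq> {}}"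

text \<open>
  In the following definitions no subtraction of naturals truncates: supports and the vertex
  set of a well-formed multihypergraph are nonempty, so \<open>blocks_met P (supp H e) \<ge> 1\<close>
  and \<open>card P \<ge> 1\<close> for every partition \<open>P\<close> of the vertex set.
\<close>

definition partition_weight :: "('v, 'e) multihypergraph \<Rightarrow> 'v set set \<Rightarrow> nat" where
  "partition_weight H P = (\<Sum>e\<in>hedges H. (blocks_met P (supp H e) - 1))"

definition weakly_partition_connected :: "nat \<Rightarrow> ('v, 'e) multihypergraph \<Rightarrow> bool" where
  "weakly_partition_connected k H \<longleftrightarrow>
     (\<forall>P. partition_on (verts H) P \<longrightarrow> partition_weight H P \<ge> k * (card P - 1))"

definition rho :: "('v, 'e) multihypergraph \<Rightarrow> nat" where
  "rho H = (\<Sum>e\<in>hedges H. (card (supp H e) - 1))"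

definition critical :: "nat \<Rightarrow> ('v, 'e) multihypergraph \<Rightarrow> bool" where
  "critical k H \<longleftrightarrow> rho H = k * (card (verts H) - 1)"

definition overfull :: "nat \<Rightarrow> ('v, 'e) multihypergraph \<Rightarrow> bool" where
  "overfull k H \<longleftrightarrow> rho H > k * (card (verts H) - 1)"


section \<open>Undirected simple trees\<close>

text \<open>An undirected edge is the two-element set of its endpoints.\<close>

definition simple_graph :: "'v set \<Rightarrow> 'v set set \<Rightarrow> bool" where
  "simple_graph W D \<longleftrightarrow> finite W \<and> (\<forall>d\<in>D. d \<subseteq> W \<and> card d = 2)"

definition connected_graph :: "'v set \<Rightarrow> 'v set set \<Rightarrow> bool" where
  "connected_graph W D \<longleftrightarrow>
     W \<noteq> {} \<and> (\<forall>u\<in>W. \<forall>v\<in>W. (u, v) \<in> {(x, y). {x, y} \<in> D}\<^sup>*)"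

definition is_cycle :: "'v set set \<Rightarrow> 'v list \<Rightarrow> bool" where
  "is_cycle D vs \<longleftrightarrow> length vs \<ge> 3 \<and> distinct vs \<and>
     (\<forall>i<length vs. {vs ! i, vs ! ((i + 1) mod length vs)} \<in> D)"

definition simple_tree :: "'v set \<Rightarrow> 'v set set \<Rightarrow> bool" where
  "simple_tree W D \<longleftrightarrow> simple_graph W D \<and> connected_graph W D \<and> (\<nexists>vs. is_cycle D vs)"


section \<open>Tree assignments and ordered tree decompositions\<close>

definition tree_assignment ::
    "('v, 'e) multihypergraph \<Rightarrow> ('e \<Rightarrow> 'v set set) \<Rightarrow> bool" where
  "tree_assignment H F \<longleftrightarrow> (\<forall>e\<in>hedges H. simple_tree (supp H e) (F e))"

text \<open>
  The pair \<open>(e, d)\<close> is the occurrence, labelled \<open>e\<close>, of the graph edge \<open>d\<close>. All labelled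
  graphs below have vertex set \<open>verts H\<close>, so each is given by its set of edge occurrences.
\<close>

definition assigned_graph ::
    "('v, 'e) multihypergraph \<Rightarrow> ('e \<Rightarrow> 'v set set) \<Rightarrow> ('e \<times> 'v set) set" where
  "assigned_graph H F = (SIGMA e:hedges H. F e)"

text \<open>Injectivity of \<^const>\<open>snd\<close> says that no two edge occurrences are parallel.\<close>

definition spanning_tree :: "'v set \<Rightarrow> ('e \<times> 'v set) set \<Rightarrow> bool" where
  "spanning_tree V T \<longleftrightarrow> inj_on snd T \<and> simple_tree V (snd ` T)"

text \<open>The list \<open>Ts\<close> consists of the edge sets of $T_0, \ldots, T_{k-1}$ in this order.\<close>

definition tree_decomposition ::
    "nat \<Rightarrow> 'v set \<Rightarrow> ('e \<times> 'v set) set \<Rightarrow> ('e \<times> 'v set) set list \<Rightarrow> bool" where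
  "tree_decomposition k V G' Ts \<longleftrightarrow>
     length Ts = k \<and> (\<Union>i<k. Ts ! i) = G' \<and> disjoint_family_on (\<lambda>i. Ts ! i) {..<k} \<and>
     (\<forall>i<k. spanning_tree V (Ts ! i))"

definition signature ::
    "('v, 'e) multihypergraph \<Rightarrow> ('e \<Rightarrow> 'v set set) \<Rightarrow> ('e \<times> 'v set) set \<Rightarrow>
     ('e \<times> 'v set) set list \<Rightarrow> 'e \<Rightarrow> nat" where
  "signature H F G' Ts =
     (\<lambda>e\<in>hedges H. \<Sum>i<length Ts. i * card (Ts ! i \<inter> ({e} \<times> F e) \<inter> G'))"

definition signature_unique ::
    "nat \<Rightarrow> ('v, 'e) multihypergraph \<Rightarrow> ('e \<Rightarrow> 'v set set) \<Rightarrow> ('e \<times> 'v set) set \<Rightarrow>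
     ('e \<times> 'v set) set list \<Rightarrow> bool" where
  "signature_unique k H F G' Ts \<longleftrightarrow>
     tree_decomposition k (verts H) G' Ts \<and>
     (\<forall>Ts'. tree_decomposition k (verts H) G' Ts' \<and>
            signature H F G' Ts' = signature H F G' Ts \<longrightarrow> Ts' = Ts)"

definition distinguishable ::
    "nat \<Rightarrow> ('v, 'e) multihypergraph \<Rightarrow> ('e \<Rightarrow> 'v set set) \<Rightarrow> bool" where
  "distinguishable k H F \<longleftrightarrow> (\<exists>Ts. signature_unique k H F (assigned_graph H F) Ts)"

definition has_distinguishable_pruning :: "nat \<Rightarrow> ('v, 'e) multihypergraph \<Rightarrow> bool" where
  "has_distinguishable_pruning k H \<longleftrightarrow>
     (\<exists>F G'. tree_assignment H F \<and> G' \<subseteq> assigned_graph H F \<and>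
             card G' = k * (card (verts H) - 1) \<and>
             (\<exists>Ts. signature_unique k H F G' Ts))"


section \<open>The universal statements\<close>

text \<open>
  The type argument only fixes the types of vertices and labels over which
  the quantified hypergraphs range.
\<close>

definition statement_B :: "('v, 'e) multihypergraph itself \<Rightarrow> nat \<Rightarrow> bool" where
  "statement_B ty k \<longleftrightarrow>
     (\<forall>H :: ('v, 'e) multihypergraph.
        wf_multihypergraph H \<and> weakly_partition_connected k H \<and> critical k H \<longrightarrow>
        (\<exists>F. tree_assignment H F \<and> distinguishable k H F))"

definition statement_C :: "('v, 'e) multihypergraph itself \<Rightarrow> nat \<Rightarrow> bool" where
  "statement_C ty k \<longleftrightarrow>
     (\<forall>H :: ('v, 'e) multihypergraph.
        wf_multihypergraph H \<and> weakly_partition_connected k H \<longrightarrow>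
        has_distinguishable_pruning k H)"

definition statement_C_overfull :: "('v, 'e) multihypergraph itself \<Rightarrow> nat \<Rightarrow> bool" where
  "statement_C_overfull ty k \<longleftrightarrow>
     (\<forall>H :: ('v, 'e) multihypergraph.
        wf_multihypergraph H \<and> weakly_partition_connected k H \<and> overfull k H \<longrightarrow>
        has_distinguishable_pruning k H)"

end

theory Submission
  imports Defs
begin

text \<open>
  The only quantity that separates the three statements is \<^const>\<open>rho\<close>. A simple tree on \<open>n\<close>
  vertices has \<open>n - 1\<close> edges (\<open>simple_tree_card\<close>), so the assigned graph of any tree assignment
  of \<open>H\<close> has exactly \<open>rho H\<close> edge occurrences (\<open>card_assigned_graph\<close>). For a \<open>k\<close>-critical \<open>H\<close> this
  is precisely the number of occurrences that a pruning has to retain, so nothing can be deleted, and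
  a distinguishable pruning is the same thing as a distinguishable full assignment
  (\<open>critical_pruning_iff\<close>). Hence (B) is (C) restricted to critical hypergraphs. It remains
  to see that critical and overfull hypergraphs exhaust the scope of (C): the partition of
  the vertices into singletons turns weak partition connectivity into \<open>rho H \<ge> k * (t - 1)\<close>
  (\<open>weakly_partition_connected_imp_rho_ge\<close>).
\<close>

section \<open>The number of edges of a tree\<close>

definition simple_path :: "'v set set \<Rightarrow> 'v set \<Rightarrow> 'v \<Rightarrow> 'v \<Rightarrow> 'v list \<Rightarrow> bool" where
  "simple_path D S u w p \<longleftrightarrow> p \<noteq> [] \<and> distinct p \<and> set p \<subseteq> S \<and> hd p = u \<and> last p = w \<and>
     successively (\<lambda>x y. {x, y} \<in> D) p"

lemma simple_path_snoc:
  assumes "simple_path D S u a p" "{a, v} \<in> D" "v \<notin> S"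
  shows "simple_path D (insert v S) u v (p @ [v])"
  using assms by (auto simp: simple_path_def successively_append_iff)

lemma simple_path_Cons:
  assumes "simple_path D S a w p" "{a, v} \<in> D" "v \<notin> S"
  shows "simple_path D (insert v S) v w (v # p)"
  using assms by (auto simp: simple_path_def successively_Cons insert_commute)

lemma simple_path_mono:
  "simple_path D S u w p \<Longrightarrow> S \<subseteq> S' \<Longrightarrow> simple_path D S' u w p"
  by (auto simp: simple_path_def)

text \<open>
  Two different neighbours of an outside vertex cannot both be ends of a path: the vertex would
  close it. As the ends differ, the path has at least two vertices, which
  gives the cycle its required length.
\<close>

lemma simple_path_closes_cycle:
  assumes p: "simple_path D S a b p" and "a \<noteq> b" "v \<notin> S" "{a, v} \<in> D" "{b, v} \<in> D"
  shows "is_cycle D (v # p)"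
proof -
  have ne: "p \<noteq> []" and hd: "hd p = a" and last: "last p = b"
    and suc: "successively (\<lambda>x y. {x, y} \<in> D) p"
    using p by (auto simp: simple_path_def)
  have len: "length p \<ge> 2"
    using ne hd last \<open>a \<noteq> b\<close> by (cases p; cases "tl p") auto
  have suc': "successively (\<lambda>x y. {x, y} \<in> D) (v # p)"
    using suc hd \<open>{a, v} \<in> D\<close> by (simp add: successively_Cons insert_commute)
  have "{(v # p) ! i, (v # p) ! ((i + 1) mod length (v # p))} \<in> D"
    if "i < length (v # p)" for i
  proof (cases "Suc i < length (v # p)")
    case True
    then have "(i + 1) mod length (v # p) = Suc i" by simp
    with successively_nth[OF suc' True] show ?thesis by (simp only:)
  next
    case False
    with that have i: "i = length p" by simp
    have "(v # p) ! length p = b"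
      using ne last by (simp add: last_conv_nth nth_Cons')
    with i \<open>{b, v} \<in> D\<close> show ?thesis by simp
  qed
  then show ?thesis
    using p len \<open>v \<notin> S\<close> by (auto simp: is_cycle_def simple_path_def)
qed

lemma connected_graph_crossing_edge:
  assumes "connected_graph W D" "S \<subseteq> W" "S \<noteq> {}" "S \<noteq> W"
  shows "\<exists>a\<in>S. \<exists>v. v \<notin> S \<and> {a, v} \<in> D"
proof (rule ccontr)
  assume "\<not> ?thesis"
  then have "{(x, y). {x, y} \<in> D} `` S \<subseteq> S" by auto
  then have "{(x, y). {x, y} \<in> D}\<^sup>* `` S = S" by (rule Image_closed_trancl)
  with assms show False unfolding connected_graph_def by blast
qed

text \<open>
  Prim's algorithm: a vertex set is grown one vertex at a time across an edge leaving
  it. Connectivity supplies the edge; acyclicity forbids a second edge from the new vertex, because the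
  part grown so far is connected by simple paths. So each step adds exactly one induced edge.
\<close>

lemma simple_tree_grow:
  assumes tree: "simple_tree W D" and "n < card W"
  shows "\<exists>S\<subseteq>W. card S = Suc n \<and> card {d \<in> D. d \<subseteq> S} = n \<and>
           (\<forall>u\<in>S. \<forall>w\<in>S. \<exists>p. simple_path D S u w p)"
  using \<open>n < card W\<close>
proof (induction n)
  have card2: "card d = 2" "d \<subseteq> W" if "d \<in> D" for d
    using tree that by (auto simp: simple_tree_def simple_graph_def)
  case 0
  then obtain x where x: "x \<in> W" by fastforce
  have "{d \<in> D. d \<subseteq> {x}} = {}"
    using card2(1)[of "{}"] card2(1)[of "{x}"] by (auto simp: subset_singleton_iff)
  moreover have "simple_path D {x} x x [x]"
    by (simp add: simple_path_def)
  ultimately show ?case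
    using x by (intro exI[of _ "{x}"]) auto
next
  have fin: "finite W" and conn: "connected_graph W D" and acyc: "\<not> is_cycle D vs"
    and card2: "d \<in> D \<Longrightarrow> card d = 2" and sub: "d \<in> D \<Longrightarrow> d \<subseteq> W" for d vs
    using tree by (auto simp: simple_tree_def simple_graph_def)
  case (Suc n)
  then obtain S where S: "S \<subseteq> W" "card S = Suc n" "card {d \<in> D. d \<subseteq> S} = n"
    and paths: "\<And>u w. u \<in> S \<Longrightarrow> w \<in> S \<Longrightarrow> \<exists>p. simple_path D S u w p"
    by auto
  from S Suc.prems have "S \<noteq> {}" "S \<noteq> W" by auto
  with connected_graph_crossing_edge[OF conn S(1)]
  obtain a v where av: "a \<in> S" "v \<notin> S" "{a, v} \<in> D" by blast
  have "finite S" using S(1) fin by (rule finite_subset)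
  have "v \<in> W" using sub av by blast
  have unique: "d = {a, v}" if d: "d \<in> D" "d \<subseteq> insert v S" "\<not> d \<subseteq> S" for d
  proof -
    from d have "v \<in> d" by blast
    with card2[OF d(1)] obtain b where b: "d = {b, v}" "b \<noteq> v"
      by (auto simp: card_2_iff)
    with d have "b \<in> S" "{b, v} \<in> D" by auto
    then have "b = a"
      using paths[OF av(1) \<open>b \<in> S\<close>] simple_path_closes_cycle[of D S a b _ v] av acyc by blast
    with b show ?thesis by simp
  qed
  have "{d \<in> D. d \<subseteq> insert v S} = insert {a, v} {d \<in> D. d \<subseteq> S}"
    using unique av by blast
  moreover have "finite {d \<in> D. d \<subseteq> S}"
    by (rule finite_subset[of _ "Pow S"]) (auto simp: \<open>finite S\<close>)
  ultimately have "card {d \<in> D. d \<subseteq> insert v S} = Suc n"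
    using av S(3) by simp
  moreover have "card (insert v S) = Suc (Suc n)"
    using \<open>finite S\<close> av S(2) by simp
  moreover have "\<exists>p. simple_path D (insert v S) u w p"
    if uw: "u \<in> insert v S" "w \<in> insert v S" for u w
  proof -
    consider "u = v" "w = v" | "u = v" "w \<in> S" | "u \<in> S" "w = v" | "u \<in> S" "w \<in> S"
      using uw by blast
    then show ?thesis
    proof cases
      case 1
      have "simple_path D (insert v S) v v [v]" by (simp add: simple_path_def)
      with 1 show ?thesis by blast
    next
      case 2
      obtain p where "simple_path D S a w p" using paths[OF av(1) 2(2)] by blast
      from simple_path_Cons[OF this av(3,2)] 2 show ?thesis by blast
    next
      case 3
      obtain p where "simple_path D S u a p" using paths[OF 3(1) av(1)] by blast
      from simple_path_snoc[OF this av(3,2)] 3 show ?thesis by blast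
    next
      case 4
      obtain p where "simple_path D S u w p" using paths[OF 4] by blast
      from simple_path_mono[OF this subset_insertI] show ?thesis by blast
    qed
  qed
  ultimately show ?case
    using S(1) \<open>v \<in> W\<close> by (intro exI[of _ "insert v S"]) auto
qed

lemma simple_tree_card:
  assumes tree: "simple_tree W D"
  shows "card D = card W - 1"
proof -
  have "finite W" "W \<noteq> {}" and sub: "\<forall>d\<in>D. d \<subseteq> W"
    using tree by (auto simp: simple_tree_def simple_graph_def connected_graph_def)
  then have pos: "card W > 0" by (simp add: card_gt_0_iff)
  then have "card W - 1 < card W" by simp
  from simple_tree_grow[OF tree this] pos obtain S
    where S: "S \<subseteq> W" "card S = card W" "card {d \<in> D. d \<subseteq> S} = card W - 1"
    by auto
  from S(1,2) \<open>finite W\<close> have "S = W" by (simp add: card_subset_eq)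
  moreover have "{d \<in> D. d \<subseteq> W} = D" using sub by auto
  ultimately show ?thesis using S(3) by simp
qed

lemma simple_tree_finite: "simple_tree W D \<Longrightarrow> finite D"
  by (rule finite_subset[of _ "Pow W"]) (auto simp: simple_tree_def simple_graph_def)

section \<open>Critical and overfull hypergraphs\<close>

lemma finite_assigned_graph:
  assumes "wf_multihypergraph H" "tree_assignment H F"
  shows "finite (assigned_graph H F)"
  using assms simple_tree_finite
  by (auto simp: assigned_graph_def wf_multihypergraph_def tree_assignment_def)

lemma card_assigned_graph:
  assumes "wf_multihypergraph H" "tree_assignment H F"
  shows "card (assigned_graph H F) = rho H"
proof -
  have "card (assigned_graph H F) = (\<Sum>e\<in>hedges H. card (F e))"
    unfolding assigned_graph_def using assms simple_tree_finite
    by (intro card_SigmaI) (auto simp: wf_multihypergraph_def tree_assignment_def)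
  also have "\<dots> = rho H"
    unfolding rho_def using assms(2)
    by (intro sum.cong) (auto simp: tree_assignment_def simple_tree_card)
  finally show ?thesis .
qed

text \<open>
  The size prescribed for a pruning is the size of the whole assigned graph when \<open>H\<close> is critical.
\<close>

lemma critical_pruning_iff:
  assumes wf: "wf_multihypergraph H" and crit: "critical k H"
  shows "has_distinguishable_pruning k H \<longleftrightarrow> (\<exists>F. tree_assignment H F \<and> distinguishable k H F)"
proof -
  have "G' \<subseteq> assigned_graph H F \<and> card G' = k * (card (verts H) - 1) \<longleftrightarrow> G' = assigned_graph H F"
    if "tree_assignment H F" for F G'
  proof -
    have "card (assigned_graph H F) = k * (card (verts H) - 1)"
      using card_assigned_graph[OF wf that] crit by (simp add: critical_def)
    with card_subset_eq[OF finite_assigned_graph[OF wf that], of G'] show ?thesis by auto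
  qed
  then have "has_distinguishable_pruning k H \<longleftrightarrow>
      (\<exists>F G'. tree_assignment H F \<and> G' = assigned_graph H F \<and> (\<exists>Ts. signature_unique k H F G' Ts))"
    unfolding has_distinguishable_pruning_def
    by (simp only: conj_assoc[symmetric] cong: conj_cong)
  then show ?thesis
    by (simp add: distinguishable_def)
qed

text \<open>
  A hyperedge meets as many singleton blocks as it has vertices, so \<^const>\<open>rho\<close> is the weight of the
  partition into singletons.
\<close>

lemma partition_weight_singletons:
  assumes "wf_multihypergraph H"
  shows "partition_weight H ((\<lambda>x. {x}) ` verts H) = rho H"
proof -
  have "blocks_met ((\<lambda>x. {x}) ` verts H) (supp H e) = card (supp H e)" if "e \<in> hedges H" for e
  proof -
    have "supp H e \<subseteq> verts H"
      using assms that by (auto simp: wf_multihypergraph_def)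
    then have "{B \<in> (\<lambda>x. {x}) ` verts H. B \<inter> supp H e \<noteq> {}} = (\<lambda>x. {x}) ` supp H e"
      by auto
    then show ?thesis by (simp add: blocks_met_def card_image)
  qed
  then show ?thesis by (simp add: partition_weight_def rho_def)
qed

lemma weakly_partition_connected_imp_rho_ge:
  assumes "wf_multihypergraph H" "weakly_partition_connected k H"
  shows "rho H \<ge> k * (card (verts H) - 1)"
proof -
  have "partition_on (verts H) ((\<lambda>x. {x}) ` verts H)"
    by (auto simp: partition_on_def disjoint_def)
  then have "partition_weight H ((\<lambda>x. {x}) ` verts H) \<ge> k * (card ((\<lambda>x. {x}) ` verts H) - 1)"
    using assms(2) by (simp add: weakly_partition_connected_def)
  then show ?thesis
    by (simp add: partition_weight_singletons[OF assms(1)] card_image)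
qed

theorem proposition6p1:
  fixes k :: nat
  assumes "k \<ge> 1"
  shows "(statement_C TYPE(('v, 'e) multihypergraph) k \<longleftrightarrow>
            statement_B TYPE(('v, 'e) multihypergraph) k \<and>
            statement_C_overfull TYPE(('v, 'e) multihypergraph) k) \<and>
         (statement_C TYPE(('v, 'e) multihypergraph) k \<longrightarrow>
            statement_B TYPE(('v, 'e) multihypergraph) k)"
proof -
  have B_iff: "statement_B TYPE(('v, 'e) multihypergraph) k \<longleftrightarrow>
      (\<forall>H :: ('v, 'e) multihypergraph.
         wf_multihypergraph H \<and> weakly_partition_connected k H \<and> critical k H \<longrightarrow>
         has_distinguishable_pruning k H)"
    unfolding statement_B_def using critical_pruning_iff by blast
  have cases: "critical k H \<or> overfull k H"
    if "wf_multihypergraph H" "weakly_partition_connected k H" for H :: "('v, 'e) multihypergraph"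
    using weakly_partition_connected_imp_rho_ge[OF that]
    by (auto simp: critical_def overfull_def)
  show ?thesis
    unfolding B_iff statement_C_def statement_C_overfull_def using cases by blast
qed

end
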